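(* Let $t,n$ be rational integers and let $\omega$ be a real quadratic irrational with $\omega^2-t\omega+n=0$. Let $h\ge 1$ and suppose that the continued fraction expansion of $\omega$ commences $$\omega=[\,A,\,a_1,\,a_2,\,\ldots,\,a_h,\,(\omega+P_{h+1})/Q_{h+1}\,],$$ where $A$ is an integer, $a_1,\ldots,a_h$ are positive integers, and the complete quotient following $a_h$ is $(\omega+P_{h+1})/Q_{h+1}$ with $P_{h+1},Q_{h+1}$ integers. Set $P=P_{h+1}$, $Q=Q_{h+1}$, and define integers $p,p',q,q'$ by $$\begin{pmatrix} a_1 & 1\\ 1& 0\end{pmatrix}\begin{pmatrix} a_2 & 1\\ 1& 0\end{pmatrix}\cdots\begin{pmatrix} a_h & 1\\ 1& 0\end{pmatrix}=\begin{pmatrix} p & p'\\ q& q'\end{pmatrix}.$$ Then both $$p(P^2+tP+n)+p'Q(A+P)=-q'Q$$ and $$p(A^2-tA+n)+q(A+P)=-q'Q.$$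
   Context: Continued fraction notation: $[a_0]=a_0$ and $[a_0,a_1,\ldots,a_m]=a_0+1/[a_1,\ldots,a_m]$, where the last entry may be any real number (a complete quotient). The complete quotients $\alpha_{j}$ of $\alpha=[a_0,a_1,a_2,\ldots]$ are defined by $\alpha=[a_0,a_1,\ldots,a_{j-1},\alpha_{j}]$. For a quadratic irrational integer $\omega$, every complete quotient has the form $(\omega+P_j)/Q_j$ with $P_j,Q_j$ rational integers, $Q_j\neq 0$. *)

theory Defs
  imports "HOL-Analysis.Analysis"
begin

(* The value for the empty list is a dummy; only nonempty lists are used. *)
fun cfrac :: "real list \<Rightarrow> real" where
  "cfrac [] = 0"
| "cfrac [x] = x"
| "cfrac (x # y # zs) = x + 1 / cfrac (y # zs)"

(* alpha = [a 0, a 1, a 2, ...], an infinite simple continued fraction, i.e. the expansion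
   of an irrational alpha. *)
definition cfrac_expansion :: "(nat \<Rightarrow> int) \<Rightarrow> real \<Rightarrow> bool" where
  "cfrac_expansion a \<alpha> \<longleftrightarrow>
     (\<forall>i\<ge>1. a i > 0) \<and>
     (\<lambda>m. cfrac (map (\<lambda>i. real_of_int (a i)) [0..<Suc m])) \<longlonglongrightarrow> \<alpha>"

(* beta is the j-th complete quotient: alpha = [a 0, ..., a (j - 1), beta].  The convention
   1 / 0 = 0 is harmless for irrational alpha: if a zero denominator occurred,
   the right-hand side would be rational. *)
definition complete_quotient :: "(nat \<Rightarrow> int) \<Rightarrow> real \<Rightarrow> nat \<Rightarrow> real \<Rightarrow> bool" where
  "complete_quotient a \<alpha> j \<beta> \<longleftrightarrow>
     \<alpha> = cfrac (map (\<lambda>i. real_of_int (a i)) [0..<j] @ [\<beta>])"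

definition mat2 :: "int \<Rightarrow> int \<Rightarrow> int \<Rightarrow> int \<Rightarrow> int ^ 2 ^ 2" where
  "mat2 x y z w = vector [vector [x, y], vector [z, w]]"

(* The ordered product of the matrices (a i, 1; 1, 0) for i = 1, ..., h, with i = 1 leftmost. *)
definition cfrac_matrix :: "(nat \<Rightarrow> int) \<Rightarrow> nat \<Rightarrow> int ^ 2 ^ 2" where
  "cfrac_matrix a h = foldr (\<lambda>i M. mat2 (a i) 1 1 0 ** M) [1..<Suc h] (mat 1)"

end

theory Submission
  imports Defs
begin

text \<open>Writing \<open>\<beta> = (\<omega> + P) / Q\<close>, the expansion says
  \<open>(\<omega> - A) (p \<beta> + p') = q \<beta> + q'\<close>. Multiplying by \<open>Q\<close> and reducing with
  \<open>\<omega>\<^sup>2 = t \<omega> - n\<close> gives a linear relation in \<open>\<omega>\<close> with integer coefficients, which must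
  both vanish; eliminating \<open>q\<close>, respectively \<open>p' Q\<close>, yields the two identities.\<close>

lemma cfrac_Cons:
  assumes "xs \<noteq> []"
  shows "cfrac (x # xs) = x + 1 / cfrac xs"
  using assms by (cases xs) auto

text \<open>Serves to exclude zero denominators: every tail ending in \<open>\<beta>\<close> is
  irrational, hence nonzero. Irrationality passes up the expansion because each step
  \<open>y \<mapsto> a j + 1 / y\<close> can be undone by rational operations.\<close>

lemma cfrac_irrational:
  assumes "\<beta> \<notin> \<rat>"
  shows "cfrac (map (\<lambda>i. real_of_int (a i)) js @ [\<beta>]) \<notin> \<rat>"
proof (induction js)
  case Nil
  then show ?case using assms by simp
next
  case (Cons j js)
  define y where "y = cfrac (map (\<lambda>i. real_of_int (a i)) js @ [\<beta>])"
  \<comment> \<open>True also for \<open>y = 0\<close>, since \<open>1 / 0 = 0\<close>, so no case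
    distinction arises.\<close>
  have "y = 1 / (of_int (a j) + 1 / y - of_int (a j))" by simp
  moreover have "y \<notin> \<rat>" using Cons.IH by (simp add: y_def)
  ultimately have "of_int (a j) + 1 / y \<notin> \<rat>"
    by (metis Rats_1 Rats_diff Rats_divide Rats_of_int)
  then show ?case by (simp add: cfrac_Cons y_def)
qed

lemma mat2_nth [simp]:
  "mat2 x y z w $ 1 $ 1 = x" "mat2 x y z w $ 1 $ 2 = y"
  "mat2 x y z w $ 2 $ 1 = z" "mat2 x y z w $ 2 $ 2 = w"
  by (simp_all add: mat2_def vector_2)

lemma mat2_mult_nth:
  "(mat2 x y z w ** N) $ 1 $ k = x * N $ 1 $ k + y * N $ 2 $ k"
  "(mat2 x y z w ** N) $ 2 $ k = z * N $ 1 $ k + w * N $ 2 $ k"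
  by (simp_all add: matrix_matrix_mult_def sum_2)

text \<open>The matrix product acts on \<open>\<beta>\<close> as a Moebius transformation. The
  cross-multiplied form avoids showing that the denominator is nonzero.\<close>

lemma cfrac_moebius:
  fixes a :: "nat \<Rightarrow> int" and js :: "nat list"
  assumes "\<beta> \<notin> \<rat>"
  defines "M \<equiv> foldr (\<lambda>i M. mat2 (a i) 1 1 0 ** M) js (mat 1)"
  shows "cfrac (map (\<lambda>i. real_of_int (a i)) js @ [\<beta>]) * (of_int (M $ 2 $ 1) * \<beta> + of_int (M $ 2 $ 2))
    = of_int (M $ 1 $ 1) * \<beta> + of_int (M $ 1 $ 2)"
  unfolding M_def
proof (induction js)
  case Nil
  then show ?case by (simp add: mat_def)
next
  case (Cons j js)
  define y where "y = cfrac (map (\<lambda>i. real_of_int (a i)) js @ [\<beta>])"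
  define N where "N = foldr (\<lambda>i M. mat2 (a i) 1 1 0 ** M) js (mat 1)"
  have "y \<noteq> 0"
    using cfrac_irrational[OF assms(1), of a js] by (auto simp: y_def)
  moreover have "y * (of_int (N $ 2 $ 1) * \<beta> + of_int (N $ 2 $ 2))
      = of_int (N $ 1 $ 1) * \<beta> + of_int (N $ 1 $ 2)"
    using Cons.IH by (simp add: y_def N_def)
  \<comment> \<open>Prepending \<open>j\<close> makes row 1 of \<open>N\<close> the new row 2, and
    \<open>a j\<close> times row 1 plus row 2 the new row 1. The quotient by \<open>y\<close>
    supplies the latter's row 2 term.\<close>
  ultimately have "(of_int (N $ 1 $ 1) * \<beta> + of_int (N $ 1 $ 2)) / y
      = of_int (N $ 2 $ 1) * \<beta> + of_int (N $ 2 $ 2)"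
    by (simp add: field_simps)
  then show ?case
    by (simp add: cfrac_Cons mat2_mult_nth algebra_simps add_divide_distrib
        flip: y_def N_def)
qed

lemma irrational_linear_eq_0:
  fixes x :: real and b c :: int
  assumes "x \<notin> \<rat>" and "of_int b * x + of_int c = 0"
  shows "b = 0" and "c = 0"
proof -
  show "b = 0"
  proof (rule ccontr)
    assume "b \<noteq> 0"
    then have "x = - of_int c / of_int b"
      using assms(2) by (simp add: field_simps)
    then show False using assms(1) by simp
  qed
  then show "c = 0" using assms(2) by simp
qed

theorem theorem2:
  fixes t n :: int and \<omega> :: real and h :: nat
    and A :: int and a :: "nat \<Rightarrow> int"
    and P Q p p' q q' :: int
  assumes "\<omega> \<notin> \<rat>"
    and "\<omega>\<^sup>2 - of_int t * \<omega> + of_int n = 0"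
    and "h \<ge> 1"
    and "cfrac_expansion a \<omega>"
    and "a 0 = A"
    and "Q \<noteq> 0"
    and "complete_quotient a \<omega> (h + 1) ((\<omega> + of_int P) / of_int Q)"
    and "cfrac_matrix a h = mat2 p p' q q'"
  shows "p * (P\<^sup>2 + t * P + n) + p' * Q * (A + P) = - q' * Q
       \<and> p * (A\<^sup>2 - t * A + n) + q * (A + P) = - q' * Q"
proof -
  define \<beta> where "\<beta> = (\<omega> + of_int P) / of_int Q"
  have \<omega>: "\<omega> = of_int Q * \<beta> - of_int P"
    using assms(6) by (simp add: \<beta>_def)
  then have \<beta>: "\<beta> \<notin> \<rat>"
    using assms(1) by auto
  define y where "y = cfrac (map (\<lambda>i. real_of_int (a i)) [1..<Suc h] @ [\<beta>])"
  \<comment> \<open>The matrix product starts at index 1, so \<open>A\<close> is split off and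
    \<open>y\<close> is the tail \<open>[a 1, ..., a h, \<beta>]\<close>.\<close>
  have "[0..<h + 1] = 0 # [1..<Suc h]"
    by (simp add: upt_conv_Cons del: upt_Suc)
  then have "\<omega> = of_int A + 1 / y"
    using assms(5,7) by (simp add: complete_quotient_def cfrac_Cons y_def \<beta>_def del: upt_Suc)
  moreover have "y \<noteq> 0"
    using cfrac_irrational[OF \<beta>, of a "[1..<Suc h]"] by (auto simp: y_def)
  ultimately have "(\<omega> - of_int A) * y = 1"
    by simp
  moreover have "y * (of_int q * \<beta> + of_int q') = of_int p * \<beta> + of_int p'"
    using cfrac_moebius[OF \<beta>, of a "[1..<Suc h]"] assms(8)
    unfolding y_def cfrac_matrix_def by simp
  \<comment> \<open>Multiplying the Moebius relation by \<open>\<omega> - A\<close>, the inverse of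
    \<open>y\<close>, removes \<open>y\<close>.\<close>
  ultimately have "(\<omega> - of_int A) * (of_int p * \<beta> + of_int p') = of_int q * \<beta> + of_int q'"
    by (metis mult.assoc mult_1)
  moreover have "of_int Q * \<beta> = \<omega> + of_int P"
    using \<omega> by simp
  ultimately have "(\<omega> - of_int A) * (of_int p * (\<omega> + of_int P) + of_int p' * of_int Q)
      = of_int q * (\<omega> + of_int P) + of_int q' * of_int Q"
    by algebra
  then have "of_int (p * (t + P - A) + p' * Q - q) * \<omega>
      + of_int (- p * n - A * (p * P + p' * Q) - q * P - q' * Q) = 0"
    using assms(2) unfolding of_int_add of_int_diff of_int_mult of_int_minus by algebra
  note irrational_linear_eq_0[OF assms(1) this]
  then show ?thesis by algebra
qed

end
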